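(* Let $S$ be a non-empty set and let $\leq$ be a generalized qualitative probability on the subsets of $S$. Then there is a preference structure satisfying postulates (Q1)--(Q6) that defines $\leq$; that is, there exist a set $F$ of consequences and a family $(\leq_D)_{D \subseteq S}$ of binary relations on the set of acts $S \to F$ satisfying (Q1)--(Q6) such that, for all $A, B \subseteq S$: $A \leq B$ if and only if, for all $c, d \in F$ with $d < c$, one has $w_A^{c,d} \leq_{A \cup B} w_B^{c,d}$.
   Context: $S$ is a non-empty set of states; events are arbitrary subsets of $S$. Generalized qualitative probability: a reflexive and transitive relation $\leq$ on the subsets of $S$ such that for all $A,B,D\subseteq S$: (1) if $A \cap D = B \cap D = \emptyset$ and $A \leq B$, then $A \cup D \leq B \cup D$; (2) if $A \cap D = B \cap D = \emptyset$, $A \cup D \leq B \cup D$ and $D \cup B \not\leq D$, then $A \leq B$; (3) if $A \cap B = \emptyset$, $A \leq B$ and $A \cup B \leq A$, then $B \leq \emptyset$; (4) $\emptyset \leq A$. Preference structures: $F$ is a set of consequences; acts are arbitrary functions $S \to F$. For each event $A$ a binary relation $\leq_A$ on acts is given. Write $f \sim_A g$ for ($f \leq_A g$ and $g \leq_A f$), $f <_A g$ for ($f \leq_A g$ and not $g \leq_A f$), and $f =_A g$ if $f(s)=g(s)$ for all $s \in A$. An event $A$ is null if $h \leq_A h'$ for all acts $h,h'$. For disjoint $A,B$, write $A \,\mathcal{N}\, B$ ($A$ is negligible compared to $B$) if for all acts $h,h'$: $h \leq_{A\cup B} h' \Leftrightarrow h \leq_B h'$. A consequence $c\in F$ is identified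 with the constant act with value $c$. For consequences, $c \leq d$ (without subscript) means $c \leq_B d$ for every event $B$ (under (Q5), if some event is non-null, this is equivalent to $c \leq_A d$ for one, equivalently every, non-null $A$), and $d < c$ means $d \leq c$ and not $c \leq d$. $w_A^{c,d}$ is the act with value $c$ on $A$ and $d$ on $S \setminus A$. Postulates (for all acts $f,g,h$ and events $A,B$): (Q1) $f \leq_A g$ and $g \leq_A h$ imply $f \leq_A h$. (Q2) $f =_A g$ implies $f \sim_A g$. (Q3) if $A \cap B = \emptyset$, $f \leq_A g$ and $f \sim_B g$, then $f \leq_{A \cup B} g$. (Q4) if $A \cap B = \emptyset$, $f \leq_{A\cup B} g$ and $f \sim_B g$, then either $f \leq_A g$ or $A \,\mathcal{N}\, B$. (Q5) if $c,d$ are constant acts, $A$ is not null and $c \leq_A d$, then $c \leq_B d$ for every event $B$. (Q6) there are consequences $c,d$ with $d < c$.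
   Formalization: The formal theorem additionally assumes that S ≤ ∅ does not hold; this excludes only the relation with A ≤ B for all A, B, which is a generalized qualitative probability but is defined by no preference structure satisfying (Q1)–(Q6). *)

theory Defs
  imports Main "HOL-Library.FuncSet"
begin

text \<open>
  The states are the elements of the type \<open>'s\<close> (types are non-empty), so events have type
  \<open>'s set\<close> and the set of all states is \<^term>\<open>UNIV\<close>.
\<close>

locale generalized_qualitative_probability =
  fixes leq :: "'s set \<Rightarrow> 's set \<Rightarrow> bool"  (infix "\<preceq>" 50)
  assumes refl: "reflp (\<preceq>)"
    and trans: "transp (\<preceq>)"
    and union_mono: "A \<inter> D = {} \<Longrightarrow> B \<inter> D = {} \<Longrightarrow> A \<preceq> B \<Longrightarrow> A \<union> D \<preceq> B \<union> D"
    and union_cancel: "A \<inter> D = {} \<Longrightarrow> B \<inter> D = {} \<Longrightarrow> A \<union> D \<preceq> B \<union> D \<Longrightarrow>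
          \<not> D \<union> B \<preceq> D \<Longrightarrow> A \<preceq> B"
    and negligible_null: "A \<inter> B = {} \<Longrightarrow> A \<preceq> B \<Longrightarrow> A \<union> B \<preceq> A \<Longrightarrow> B \<preceq> {}"
    and empty_least: "{} \<preceq> A"

text \<open>
  The consequences form a set \<open>F\<close>, and \<open>pref D f g\<close> stands for \<open>f \<le>\<^sub>D g\<close>. Only the values of
  \<open>pref\<close> on acts, that is on functions with all values in \<open>F\<close>, are relevant.
\<close>

locale conditional_preferences =
  fixes F :: "'c set"
    and pref :: "'s set \<Rightarrow> ('s \<Rightarrow> 'c) \<Rightarrow> ('s \<Rightarrow> 'c) \<Rightarrow> bool"
begin

definition acts :: "('s \<Rightarrow> 'c) set" where
  "acts = (UNIV \<rightarrow> F)"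

definition indiff :: "'s set \<Rightarrow> ('s \<Rightarrow> 'c) \<Rightarrow> ('s \<Rightarrow> 'c) \<Rightarrow> bool" where
  "indiff A f g \<longleftrightarrow> pref A f g \<and> pref A g f"

definition null :: "'s set \<Rightarrow> bool" where
  "null A \<longleftrightarrow> (\<forall>h\<in>acts. \<forall>h'\<in>acts. pref A h h')"

definition negligible :: "'s set \<Rightarrow> 's set \<Rightarrow> bool" where
  "negligible A B \<longleftrightarrow> A \<inter> B = {} \<and> (\<forall>h\<in>acts. \<forall>h'\<in>acts. pref (A \<union> B) h h' \<longleftrightarrow> pref B h h')"

definition cons_le :: "'c \<Rightarrow> 'c \<Rightarrow> bool" where
  "cons_le c d \<longleftrightarrow> (\<forall>B. pref B (\<lambda>_. c) (\<lambda>_. d))"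

definition cons_less :: "'c \<Rightarrow> 'c \<Rightarrow> bool" where
  "cons_less d c \<longleftrightarrow> cons_le d c \<and> \<not> cons_le c d"

definition bet :: "'s set \<Rightarrow> 'c \<Rightarrow> 'c \<Rightarrow> 's \<Rightarrow> 'c" where
  "bet A c d = (\<lambda>s. if s \<in> A then c else d)"

definition represents :: "('s set \<Rightarrow> 's set \<Rightarrow> bool) \<Rightarrow> bool" where
  "represents leq \<longleftrightarrow> (\<forall>A B. leq A B \<longleftrightarrow>
     (\<forall>c\<in>F. \<forall>d\<in>F. cons_less d c \<longrightarrow> pref (A \<union> B) (bet A c d) (bet B c d)))"

end

locale preference_structure = conditional_preferences F pref
  for F :: "'c set" and pref :: "'s set \<Rightarrow> ('s \<Rightarrow> 'c) \<Rightarrow> ('s \<Rightarrow> 'c) \<Rightarrow> bool" +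
  assumes Q1: "f \<in> acts \<Longrightarrow> g \<in> acts \<Longrightarrow> h \<in> acts \<Longrightarrow>
      pref A f g \<Longrightarrow> pref A g h \<Longrightarrow> pref A f h"
    and Q2: "f \<in> acts \<Longrightarrow> g \<in> acts \<Longrightarrow> (\<And>s. s \<in> A \<Longrightarrow> f s = g s) \<Longrightarrow> indiff A f g"
    and Q3: "f \<in> acts \<Longrightarrow> g \<in> acts \<Longrightarrow> A \<inter> B = {} \<Longrightarrow>
      pref A f g \<Longrightarrow> indiff B f g \<Longrightarrow> pref (A \<union> B) f g"
    and Q4: "f \<in> acts \<Longrightarrow> g \<in> acts \<Longrightarrow> A \<inter> B = {} \<Longrightarrow>
      pref (A \<union> B) f g \<Longrightarrow> indiff B f g \<Longrightarrow> pref A f g \<or> negligible A B"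
    and Q5: "c \<in> F \<Longrightarrow> d \<in> F \<Longrightarrow> \<not> null A \<Longrightarrow>
      pref A (\<lambda>_. c) (\<lambda>_. d) \<Longrightarrow> pref B (\<lambda>_. c) (\<lambda>_. d)"
    and Q6: "\<exists>c\<in>F. \<exists>d\<in>F. cons_less d c"
begin

text \<open>
  If \<open>UNIV \<le> {}\<close>, then every event is equivalent to the empty one and \<open>c \<le> d\<close> would follow for
  consequences \<open>d < c\<close>. The axioms of a generalized qualitative probability alone do not exclude
  this: they hold for the all-relation (second lemma below). So \<open>\<not> UNIV \<le> {}\<close> is a necessary
  hypothesis for the existence of a representation.
\<close>

lemma represents_nontrivial:
  assumes "generalized_qualitative_probability leq" and "represents leq"
  shows "\<not> leq UNIV {}"
proof
  interpret generalized_qualitative_probability leq by fact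
  assume UNIV: "leq UNIV {}"
  have all: "leq A {}" for A
  proof -
    have "leq ({} \<union> A) (- A \<union> A)" by (rule union_mono) (auto simp: empty_least)
    then have "leq A UNIV" by simp
    then show ?thesis using UNIV trans by (blast dest: transpD)
  qed
  obtain c d where cd: "c \<in> F" "d \<in> F" "cons_less d c" using Q6 by blast
  have acts: "bet A c d \<in> acts" "(\<lambda>_. c) \<in> acts" "(\<lambda>_. d) \<in> acts" for A
    using cd by (auto simp: acts_def bet_def)
  have "pref A (\<lambda>_. c) (\<lambda>_. d)" for A
  proof -
    have "pref (A \<union> {}) (bet A c d) (bet {} c d)"
      using assms(2) all[of A] cd unfolding represents_def by blast
    then have "pref A (bet A c d) (\<lambda>_. d)" by (simp add: bet_def)
    moreover have "indiff A (\<lambda>_. c) (bet A c d)"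
      using acts by (intro Q2) (auto simp: bet_def)
    ultimately show ?thesis using Q1 acts unfolding indiff_def by blast
  qed
  then show False using cd(3) unfolding cons_less_def cons_le_def by blast
qed

end

lemma all_relation_is_generalized_qualitative_probability:
  "generalized_qualitative_probability (\<lambda>A B. True)"
  by unfold_locales (auto simp: reflp_def transp_def)

end

(*
  Take the two consequences 0 and 1, so that acts are indicators of events. Call X ignorable in D
  when D \<preceq> D - X, that is, when the rest of D absorbs X. The events ignorable in D form an ideal
  that is closed downwards under \<preceq>, and a subset of D that is not ignorable in D absorbs every
  ignorable one. Conditional preference given D compares the traces of two events on D by \<preceq>, except
  that events ignorable in D are placed at the bottom; A is negligible compared to B as soon as it
  is ignorable in A \<union> B.
*)

theory Submission
  imports Defs
begin

context generalized_qualitative_probability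
begin

section \<open>Elementary consequences of the axioms\<close>

lemma leq_refl: "A \<preceq> A"
  using refl by (simp add: reflp_def)

lemma leq_trans: "A \<preceq> B \<Longrightarrow> B \<preceq> C \<Longrightarrow> A \<preceq> C"
  using trans by (rule transpD)

lemma subset_imp_leq:
  assumes "A \<subseteq> B"
  shows "A \<preceq> B"
proof -
  have "{} \<union> A \<preceq> (B - A) \<union> A" by (rule union_mono) (auto simp: empty_least)
  with assms show ?thesis by (simp add: Un_absorb2)
qed

text \<open>One summand is replaced at a time; the intermediate event is
  \<open>A' \<union> B\<close>, whence the third disjointness condition.\<close>

lemma union_mono2:
  assumes "A \<inter> B = {}" "A' \<inter> B' = {}" "A' \<inter> B = {}" "A \<preceq> A'" "B \<preceq> B'"
  shows "A \<union> B \<preceq> A' \<union> B'"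
proof -
  have "A \<union> B \<preceq> A' \<union> B" using assms by (intro union_mono)
  moreover have "B \<union> A' \<preceq> B' \<union> A'" using assms by (intro union_mono) auto
  ultimately show ?thesis by (metis Un_commute leq_trans)
qed

section \<open>The ideal of ignorable events, and absorption\<close>

definition ignorable :: "'s set \<Rightarrow> 's set \<Rightarrow> bool" where
  "ignorable D X \<longleftrightarrow> D \<preceq> D - X"

lemma ignorable_empty: "ignorable D {}"
  by (simp add: ignorable_def leq_refl)

lemma ignorable_self_iff: "ignorable D D \<longleftrightarrow> D \<preceq> {}"
  by (simp add: ignorable_def)

lemma ignorable_subset: "ignorable D X \<Longrightarrow> Y \<inter> D \<subseteq> X \<Longrightarrow> ignorable D Y"
  unfolding ignorable_def by (erule leq_trans) (auto intro: subset_imp_leq)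

lemma ignorable_union:
  assumes "ignorable D X" "ignorable D Y"
  shows "ignorable D (X \<union> Y)"
proof -
  define P where "P = X \<inter> D"
  define Q where "Q = Y \<inter> D - X"
  define Z where "Z = D - X - Y"
  have D: "D = P \<union> Q \<union> Z" and disj: "P \<inter> Q = {}" "P \<inter> Z = {}" "Q \<inter> Z = {}"
    by (auto simp: P_def Q_def Z_def)
  have "ignorable D P" using assms(1) by (rule ignorable_subset) (auto simp: P_def)
  moreover have "ignorable D Q" using assms(2) by (rule ignorable_subset) (auto simp: Q_def)
  moreover have "D - P = Z \<union> Q" "D - Q = Z \<union> P" using D disj by auto
  ultimately have DP: "D \<preceq> Z \<union> Q" and DQ: "D \<preceq> Z \<union> P" by (simp_all add: ignorable_def)
  have "D \<preceq> Z"
  proof -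
    consider "Q \<union> Z \<preceq> Q" "P \<union> Z \<preceq> P" | "\<not> Q \<union> Z \<preceq> Q" | "\<not> P \<union> Z \<preceq> P" by blast
    then show ?thesis
    proof cases
      \<comment> \<open>Cancellation is blocked on both sides, so \<open>P\<close> and
        \<open>Q\<close> are each equivalent to \<open>D\<close>. Then
        \<open>negligible_null\<close> makes \<open>Q\<close>, and with it all of \<open>D\<close>,
        equivalent to the empty event.\<close>
      case 1
      then have "D \<preceq> Q" "D \<preceq> P" using DP DQ by (metis Un_commute leq_trans)+
      then have "P \<preceq> Q" "P \<union> Q \<preceq> P"
        using D by (meson leq_trans subset_imp_leq sup_ge1 order_trans)+
      then have "Q \<preceq> {}" using negligible_null disj by blast
      then show ?thesis using \<open>D \<preceq> Q\<close> empty_least leq_trans by blast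
    next
      \<comment> \<open>Here \<open>Q\<close> can be cancelled: \<open>Z\<close> absorbs
        \<open>P\<close>, while \<open>Z \<union> P\<close> already dominates
        \<open>D\<close>.\<close>
      case 2
      have "(P \<union> Z) \<union> Q \<preceq> Z \<union> Q" using DP D by (simp add: Un_ac)
      then have "P \<union> Z \<preceq> Z"
        using 2 disj by (intro union_cancel[of "P \<union> Z" Q Z]) auto
      then show ?thesis using DQ by (metis Un_commute leq_trans)
    next
      case 3
      have "(Q \<union> Z) \<union> P \<preceq> Z \<union> P" using DQ D by (simp add: Un_ac)
      then have "Q \<union> Z \<preceq> Z"
        using 3 disj by (intro union_cancel[of "Q \<union> Z" P Z]) auto
      then show ?thesis using DP by (metis Un_commute leq_trans)
    qed
  qed
  moreover have "Z = D - (X \<union> Y)" by (auto simp: Z_def)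
  ultimately show ?thesis by (simp add: ignorable_def)
qed

text \<open>Since \<open>V - U\<close> is below \<open>U\<close>, exchanging the two shows that
  removing \<open>V - U\<close> leaves at least as much of \<open>D\<close> as removing
  \<open>U\<close>. So \<open>V - U\<close> is ignorable too, and \<open>U \<union> V\<close> is a
  union of two ignorable events.\<close>

lemma ignorable_leq:
  assumes "ignorable D U" "V \<preceq> U" "U \<subseteq> D" "V \<subseteq> D"
  shows "ignorable D V"
proof -
  define W where "W = V - U"
  define Z where "Z = D - U - V"
  have "W \<preceq> U" using assms(2) leq_trans subset_imp_leq[of W V] by (auto simp: W_def)
  then have "W \<union> Z \<preceq> U \<union> Z" by (intro union_mono) (auto simp: W_def Z_def)
  moreover have "D - U = W \<union> Z" "D - W = U \<union> Z" using assms by (auto simp: W_def Z_def)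
  ultimately have "ignorable D W" using assms(1) leq_trans by (auto simp: ignorable_def)
  then have "ignorable D (U \<union> W)" using assms(1) ignorable_union by blast
  then show ?thesis by (rule ignorable_subset) (auto simp: W_def)
qed

lemma ignorable_superset:
  assumes "ignorable D X" "D \<subseteq> E" "X \<subseteq> D"
  shows "ignorable E X"
proof -
  have "D \<union> (E - D) \<preceq> (D - X) \<union> (E - D)"
    using assms by (intro union_mono) (auto simp: ignorable_def)
  moreover have "D \<union> (E - D) = E" "(D - X) \<union> (E - D) = E - X" using assms by auto
  ultimately show ?thesis by (simp add: ignorable_def)
qed

text \<open>The part of \<open>D\<close> outside \<open>X \<union> Y\<close> is cancelled. This is
  legitimate because, if that part absorbed \<open>Y\<close>, it would dominate \<open>D\<close> and
  make \<open>Y\<close> ignorable.\<close>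

lemma ignorable_absorbed:
  assumes "ignorable D X" "\<not> ignorable D Y" "X \<subseteq> D" "Y \<subseteq> D"
  shows "X \<union> Y \<preceq> Y"
proof -
  define W where "W = X - Y"
  define Z where "Z = D - X - Y"
  have "ignorable D W" using assms(1) by (rule ignorable_subset) (auto simp: W_def)
  moreover have D: "D = (W \<union> Y) \<union> Z" and "D - W = Y \<union> Z"
    using assms by (auto simp: W_def Z_def)
  ultimately have DY: "(W \<union> Y) \<union> Z \<preceq> Y \<union> Z" by (simp add: ignorable_def)
  have "\<not> Z \<union> Y \<preceq> Z"
  proof
    assume "Z \<union> Y \<preceq> Z"
    then have "D \<preceq> Z" using DY D by (metis Un_commute leq_trans)
    then have "D \<preceq> D - Y" using leq_trans subset_imp_leq[of Z "D - Y"] by (auto simp: Z_def)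
    with assms(2) show False by (simp add: ignorable_def)
  qed
  then have "W \<union> Y \<preceq> Y"
    using DY by (intro union_cancel[of "W \<union> Y" Z Y]) (auto simp: W_def Z_def)
  moreover have "W \<union> Y = X \<union> Y" by (auto simp: W_def)
  ultimately show ?thesis by simp
qed

lemma absorbed_ignorable:
  assumes "X \<union> Y \<preceq> Y" "X \<inter> Y = {}" "X \<union> Y \<subseteq> D"
  shows "ignorable D X"
proof -
  have "(X \<union> Y) - X = Y" using assms by auto
  then have "ignorable (X \<union> Y) X" using assms by (simp add: ignorable_def)
  then show ?thesis using assms ignorable_superset by blast
qed

text \<open>A converse to \<open>ignorable_superset\<close>, obtained by cancelling
  \<open>B\<close>. If \<open>B\<close> absorbed \<open>A - X\<close>, it would dominate
  \<open>A \<union> B\<close>, and \<open>A\<close> would be ignorable.\<close>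

lemma ignorable_restrict:
  assumes "ignorable (A \<union> B) X" "\<not> ignorable (A \<union> B) A" "A \<inter> B = {}" "X \<subseteq> A"
  shows "ignorable A X"
proof -
  have "A \<union> B - X = (A - X) \<union> B" using assms(3,4) by auto
  then have AB: "A \<union> B \<preceq> (A - X) \<union> B" using assms(1) by (simp add: ignorable_def)
  have "\<not> B \<union> (A - X) \<preceq> B"
  proof
    assume "B \<union> (A - X) \<preceq> B"
    then have "A \<union> B \<preceq> B" using AB by (metis Un_commute leq_trans)
    with assms(2,3) show False using absorbed_ignorable by blast
  qed
  then have "A \<preceq> A - X" using AB assms(3) by (intro union_cancel[of A B "A - X"]) auto
  then show ?thesis by (simp add: ignorable_def)
qed

section \<open>Comparison of events conditional on an event\<close>

definition cond_leq :: "'s set \<Rightarrow> 's set \<Rightarrow> 's set \<Rightarrow> bool" where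
  "cond_leq D P Q \<longleftrightarrow> ignorable D (P \<inter> D) \<or> P \<inter> D \<preceq> Q \<inter> D"

lemma cond_leq_refl: "cond_leq D P P"
  by (simp add: cond_leq_def leq_refl)

text \<open>The critical case has \<open>P\<close> below an ignorable \<open>Q\<close>; there
  \<open>ignorable_leq\<close> makes \<open>P\<close> ignorable.\<close>

lemma cond_leq_trans: "cond_leq D P Q \<Longrightarrow> cond_leq D Q R \<Longrightarrow> cond_leq D P R"
  unfolding cond_leq_def by (meson ignorable_leq leq_trans inf_le2)

lemma cond_leq_empty: "cond_leq D {} Q"
  by (simp add: cond_leq_def ignorable_empty)

lemma cond_leq_UNIV_empty_iff: "cond_leq D UNIV {} \<longleftrightarrow> D \<preceq> {}"
  by (simp add: cond_leq_def ignorable_self_iff)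

lemma cond_leq_null: "D \<preceq> {} \<Longrightarrow> cond_leq D P Q"
  unfolding cond_leq_def using ignorable_self_iff ignorable_subset by blast

text \<open>This is what makes bets recover the given relation. The ignorability clause adds nothing
  here: an \<open>A\<close> ignorable in \<open>A \<union> B\<close> is below
  \<open>A \<union> B - A\<close>, which lies inside \<open>B\<close>.\<close>

lemma cond_leq_union_iff: "cond_leq (A \<union> B) A B \<longleftrightarrow> A \<preceq> B"
proof -
  have "A \<preceq> B" if "ignorable (A \<union> B) A"
  proof -
    have "A \<preceq> A \<union> B - A" using that leq_trans[of A "A \<union> B"]
      by (auto simp: ignorable_def intro: subset_imp_leq)
    then show ?thesis using leq_trans[of A "A \<union> B - A" B] by (auto intro: subset_imp_leq)
  qed
  then show ?thesis by (auto simp: cond_leq_def Int_absorb2)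
qed

text \<open>Splits the indifference hypothesis of \<open>Q3\<close> and \<open>Q4\<close>; the mixed
  cases collapse because ignorability passes downwards.\<close>

lemma cond_leq_symmetric_cases:
  assumes "cond_leq D P Q" "cond_leq D Q P"
  obtains "ignorable D (P \<inter> D)" "ignorable D (Q \<inter> D)" | "P \<inter> D \<preceq> Q \<inter> D" "Q \<inter> D \<preceq> P \<inter> D"
  using assms unfolding cond_leq_def by (meson ignorable_leq inf_le2)

text \<open>The core of \<open>Q3\<close>. When the trace of \<open>P\<close> on
  \<open>A \<union> B\<close> is not ignorable, at least one of its parts in \<open>A\<close> and
  \<open>B\<close> is not, and any ignorable part is absorbed by a part that is not.\<close>

lemma cond_leq_union:
  assumes "A \<inter> B = {}" "cond_leq A P Q" "cond_leq B P Q" "cond_leq B Q P"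
  shows "cond_leq (A \<union> B) P Q"
proof (cases "ignorable (A \<union> B) (P \<inter> (A \<union> B))")
  case True
  then show ?thesis by (simp add: cond_leq_def)
next
  case False
  have disj: "X \<inter> A \<inter> (Y \<inter> B) = {}" for X Y using assms(1) by auto
  have split: "X \<inter> (A \<union> B) = X \<inter> A \<union> X \<inter> B" for X by auto
  have not_both: "\<not> (ignorable (A \<union> B) (P \<inter> A) \<and> ignorable (A \<union> B) (P \<inter> B))"
    using False ignorable_union split by metis
  have lift: "ignorable A (X \<inter> A) \<Longrightarrow> ignorable (A \<union> B) (X \<inter> A)"
    "ignorable B (X \<inter> B) \<Longrightarrow> ignorable (A \<union> B) (X \<inter> B)" for X
    by (auto elim: ignorable_superset)
  have "P \<inter> A \<union> P \<inter> B \<preceq> Q \<inter> A \<union> Q \<inter> B"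
    using assms(3,4)
  proof (cases rule: cond_leq_symmetric_cases)
    case 1
    then have B: "ignorable (A \<union> B) (P \<inter> B)" using lift by blast
    then have nA: "\<not> ignorable (A \<union> B) (P \<inter> A)" using not_both by blast
    then have PQ: "P \<inter> A \<preceq> Q \<inter> A" using assms(2) lift unfolding cond_leq_def by blast
    \<comment> \<open>Non-ignorability passes upwards from \<open>P \<inter> A\<close>, so
      \<open>Q \<inter> A\<close> is large enough to absorb \<open>P \<inter> B\<close>.\<close>
    then have "\<not> ignorable (A \<union> B) (Q \<inter> A)" using nA ignorable_leq by (metis inf_le2 le_supI1)
    then have "P \<inter> B \<union> Q \<inter> A \<preceq> Q \<inter> A" using B by (intro ignorable_absorbed) auto
    moreover have "P \<inter> A \<union> P \<inter> B \<preceq> Q \<inter> A \<union> P \<inter> B" using disj PQ by (intro union_mono)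
    ultimately show ?thesis by (metis Un_commute leq_trans subset_imp_leq sup_ge1)
  next
    case 2
    show ?thesis
    proof (cases "ignorable A (P \<inter> A)")
      case True
      then have "P \<inter> A \<union> P \<inter> B \<preceq> P \<inter> B"
        using not_both lift by (intro ignorable_absorbed) auto
      then show ?thesis using 2 by (meson leq_trans subset_imp_leq sup_ge2)
    next
      case False
      then show ?thesis using 2 assms(2) disj by (intro union_mono2) (auto simp: cond_leq_def)
    qed
  qed
  then show ?thesis by (simp add: cond_leq_def split)
qed

text \<open>Deleting an ignorable \<open>A\<close> changes neither which traces are ignorable nor,
  by absorption, the comparison of the others.\<close>

lemma cond_leq_ignorable:
  assumes "A \<inter> B = {}" "ignorable (A \<union> B) A"
  shows "cond_leq (A \<union> B) P Q \<longleftrightarrow> cond_leq B P Q"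
proof -
  have split: "X \<inter> (A \<union> B) = X \<inter> A \<union> X \<inter> B" for X by auto
  have ign: "ignorable (A \<union> B) (X \<inter> A)" for X using assms(2) by (rule ignorable_subset) auto
  have B: "ignorable (A \<union> B) (X \<inter> B) \<longleftrightarrow> ignorable B (X \<inter> B)" for X
  proof
    assume "ignorable (A \<union> B) (X \<inter> B)"
    then have "ignorable (A \<union> B) (A \<union> X \<inter> B)" using assms(2) ignorable_union by blast
    moreover have "A \<union> B - (A \<union> X \<inter> B) = B - X \<inter> B" using assms(1) by auto
    ultimately have "A \<union> B \<preceq> B - X \<inter> B" by (simp add: ignorable_def)
    then show "ignorable B (X \<inter> B)"
      unfolding ignorable_def by (meson leq_trans subset_imp_leq sup_ge2)
  qed (auto elim: ignorable_superset)
  have iff: "ignorable (A \<union> B) (X \<inter> (A \<union> B)) \<longleftrightarrow> ignorable B (X \<inter> B)" for X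
    using B ign ignorable_union split ignorable_subset by (metis inf_le1 sup_ge2 order_trans)
  have absorbed: "X \<inter> (A \<union> B) \<preceq> X \<inter> B" if "\<not> ignorable B (X \<inter> B)" for X
    unfolding split using ign B that by (intro ignorable_absorbed[of "A \<union> B"]) auto
  have sub: "X \<inter> B \<preceq> X \<inter> (A \<union> B)" for X by (rule subset_imp_leq) auto
  show ?thesis
  proof (cases "ignorable B (P \<inter> B)")
    case True
    then show ?thesis using iff by (simp add: cond_leq_def)
  next
    case False
    have "P \<inter> (A \<union> B) \<preceq> Q \<inter> (A \<union> B) \<longleftrightarrow> P \<inter> B \<preceq> Q \<inter> B"
    proof
      assume *: "P \<inter> (A \<union> B) \<preceq> Q \<inter> (A \<union> B)"
      \<comment> \<open>Absorption is needed on the side of \<open>Q\<close>, so its trace must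
        first be shown not to be ignorable.\<close>
      then have "\<not> ignorable B (Q \<inter> B)" using False iff ignorable_leq by (metis inf_le2)
      then show "P \<inter> B \<preceq> Q \<inter> B" using * absorbed sub leq_trans by meson
    next
      assume "P \<inter> B \<preceq> Q \<inter> B"
      then show "P \<inter> (A \<union> B) \<preceq> Q \<inter> (A \<union> B)" using absorbed[OF False] sub leq_trans by meson
    qed
    then show ?thesis using False iff by (simp add: cond_leq_def)
  qed
qed

text \<open>The core of \<open>Q4\<close>: the parts in \<open>B\<close> are either absorbed or
  cancelled.\<close>

lemma cond_leq_cancel:
  assumes "A \<inter> B = {}" "cond_leq (A \<union> B) P Q" "cond_leq B P Q" "cond_leq B Q P"
    and A: "\<not> ignorable (A \<union> B) A"
  shows "cond_leq A P Q"
proof (cases "ignorable (A \<union> B) (P \<inter> A)")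
  case True
  \<comment> \<open>An event that is ignorable in \<open>A \<union> B\<close> could in principle
    carry weight in \<open>A\<close>; the assumption that \<open>A\<close> itself is not ignorable
    excludes this.\<close>
  then show ?thesis using ignorable_restrict assms(1) A unfolding cond_leq_def by (metis inf_le2)
next
  case False
  have disj: "X \<inter> A \<inter> (Y \<inter> B) = {}" for X Y using assms(1) by auto
  have split: "X \<inter> (A \<union> B) = X \<inter> A \<union> X \<inter> B" for X by auto
  have "\<not> ignorable (A \<union> B) (P \<inter> (A \<union> B))" using False ignorable_subset by blast
  then have PQ: "P \<inter> A \<union> P \<inter> B \<preceq> Q \<inter> A \<union> Q \<inter> B"
    using assms(2) by (simp add: cond_leq_def split)
  have "P \<inter> A \<preceq> Q \<inter> A"
    using assms(3,4)
  proof (cases rule: cond_leq_symmetric_cases)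
    case 1
    then have QB: "ignorable (A \<union> B) (Q \<inter> B)" by (auto elim: ignorable_superset)
    have PA: "P \<inter> A \<preceq> Q \<inter> A \<union> Q \<inter> B" using PQ by (meson leq_trans subset_imp_leq sup_ge1)
    have "\<not> ignorable (A \<union> B) (Q \<inter> A)"
    proof
      assume "ignorable (A \<union> B) (Q \<inter> A)"
      then have "ignorable (A \<union> B) (Q \<inter> A \<union> Q \<inter> B)" using QB ignorable_union by blast
      then show False using PA False by (auto dest: ignorable_leq)
    qed
    then have "Q \<inter> B \<union> Q \<inter> A \<preceq> Q \<inter> A" using QB by (intro ignorable_absorbed) auto
    then show ?thesis using PA by (metis Un_commute leq_trans)
  next
    case 2
    have "Q \<inter> B \<union> Q \<inter> A \<preceq> P \<inter> B \<union> Q \<inter> A"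
      using 2 disj by (intro union_mono) (auto simp: Int_commute)
    then have *: "P \<inter> A \<union> P \<inter> B \<preceq> Q \<inter> A \<union> P \<inter> B" using PQ by (metis Un_commute leq_trans)
    \<comment> \<open>Side condition for cancelling \<open>P \<inter> B\<close>: its failure would
      let \<open>P \<inter> B\<close> absorb \<open>P \<inter> A\<close>, making the latter
      ignorable.\<close>
    have "\<not> P \<inter> B \<union> Q \<inter> A \<preceq> P \<inter> B"
    proof
      assume "P \<inter> B \<union> Q \<inter> A \<preceq> P \<inter> B"
      then have "P \<inter> A \<union> P \<inter> B \<preceq> P \<inter> B" using * by (metis Un_commute leq_trans)
      then have "ignorable (A \<union> B) (P \<inter> A)" using disj by (intro absorbed_ignorable) auto
      with False show False ..
    qed
    then show ?thesis using * disj by (intro union_cancel[of "P \<inter> A" "P \<inter> B" "Q \<inter> A"])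
  qed
  then show ?thesis by (simp add: cond_leq_def)
qed

section \<open>Preferences between indicator acts, and the postulates\<close>

definition act_leq :: "'s set \<Rightarrow> ('s \<Rightarrow> nat) \<Rightarrow> ('s \<Rightarrow> nat) \<Rightarrow> bool" where
  "act_leq D f g \<longleftrightarrow> cond_leq D {s. f s = 1} {s. g s = 1}"

sublocale act: conditional_preferences "{0, 1}" act_leq .

lemma act_null: "D \<preceq> {} \<Longrightarrow> act.null D"
  unfolding act.null_def act_leq_def by (blast intro: cond_leq_null)

lemma act_leq_const_iff:
  assumes "c \<in> {0, 1}" "d \<in> {0, 1}"
  shows "act_leq D (\<lambda>_. c) (\<lambda>_. d) \<longleftrightarrow> D \<preceq> {} \<or> c \<le> d"
proof -
  have "cond_leq D UNIV UNIV" by (rule cond_leq_refl)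
  then show ?thesis
    using assms by (auto simp: act_leq_def cond_leq_empty cond_leq_UNIV_empty_iff)
qed

text \<open>Nontriviality enters here: conditional on \<open>UNIV\<close>, the consequence 1 is not
  weakly below 0.\<close>

lemma act_cons_less_iff:
  assumes "\<not> UNIV \<preceq> {}" "c \<in> {0, 1}" "d \<in> {0, 1}"
  shows "act.cons_less d c \<longleftrightarrow> d < c"
  using assms(1) unfolding act.cons_less_def act.cons_le_def
    act_leq_const_iff[OF assms(2,3)] act_leq_const_iff[OF assms(3,2)] by auto

lemma act_negligible:
  assumes "A \<inter> B = {}" "ignorable (A \<union> B) A"
  shows "act.negligible A B"
  using assms cond_leq_ignorable unfolding act.negligible_def act_leq_def by blast

lemma act_preference_structure:
  assumes "\<not> UNIV \<preceq> {}"
  shows "preference_structure {0, 1} act_leq"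
proof
  fix f g h A
  assume "act_leq A f g" "act_leq A g h"
  then show "act_leq A f h" unfolding act_leq_def by (rule cond_leq_trans)
next
  fix f g :: "'s \<Rightarrow> nat" and A
  assume "\<And>s. s \<in> A \<Longrightarrow> f s = g s"
  then have "{s. f s = 1} \<inter> A = {s. g s = 1} \<inter> A" by auto
  then show "act.indiff A f g"
    unfolding act.indiff_def act_leq_def by (simp add: cond_leq_def leq_refl)
next
  fix f g A B
  assume "A \<inter> B = {}" "act_leq A f g" "act.indiff B f g"
  then show "act_leq (A \<union> B) f g" by (simp add: act.indiff_def act_leq_def cond_leq_union)
next
  fix f g A B
  assume "A \<inter> B = {}" "act_leq (A \<union> B) f g" "act.indiff B f g"
  then show "act_leq A f g \<or> act.negligible A B"
    \<comment> \<open>The two alternatives correspond to whether \<open>A\<close> is ignorable in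
      \<open>A \<union> B\<close>.\<close>
    using act_negligible cond_leq_cancel unfolding act.indiff_def act_leq_def by blast
next
  fix c d :: nat and A B
  assume "c \<in> {0, 1}" "d \<in> {0, 1}" "\<not> act.null A" "act_leq A (\<lambda>_. c) (\<lambda>_. d)"
  then show "act_leq B (\<lambda>_. c) (\<lambda>_. d)" using act_null act_leq_const_iff by blast
next
  show "\<exists>c\<in>{0, 1}. \<exists>d\<in>{0, 1}. act.cons_less d c"
    using act_cons_less_iff[OF assms, of 1 0] by auto
qed

lemma act_represents:
  assumes "\<not> UNIV \<preceq> {}"
  shows "act.represents (\<preceq>)"
proof -
  \<comment> \<open>The only strictly ordered pair of consequences is 0 below 1, so these bets are
    the only ones to test.\<close>
  have "act_leq (A \<union> B) (act.bet A 1 0) (act.bet B 1 0) \<longleftrightarrow> A \<preceq> B" for A B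
    by (simp add: act_leq_def act.bet_def cond_leq_union_iff)
  then show ?thesis
    using act_cons_less_iff[OF assms] unfolding act.represents_def by force
qed

end

theorem theorem1:
  fixes leq :: "'s set \<Rightarrow> 's set \<Rightarrow> bool"
  assumes "generalized_qualitative_probability leq"
    and nontrivial: "\<not> leq UNIV {}"
  shows "\<exists>(F :: nat set) (pref :: 's set \<Rightarrow> ('s \<Rightarrow> nat) \<Rightarrow> ('s \<Rightarrow> nat) \<Rightarrow> bool).
           preference_structure F pref \<and> conditional_preferences.represents F pref leq"
  using generalized_qualitative_probability.act_preference_structure[OF assms]
    generalized_qualitative_probability.act_represents[OF assms] by blast

end
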